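(* Let $S$ be a finite non-empty set, let $d\ge2$ and $k\ge1$ be integers and let $\epsilon\in(0,1)$. Let $P$ be an $S$-path. Then there is an $S$-path $Q$ such that $$\|\mathrm{freq}_k(P)-\mathrm{freq}_k(Q)\|_1\le\epsilon\quad\text{and}\quad |Q|\le\frac{24960\,d^{3k}\,|S|^2\,L_S(d,k)^6}{\epsilon^2}.$$
   Context: An $S$-graph is a pair $G=(V,I)$ with $V$ a finite vertex set and $I:V\times V\to\{0\}\cup(\{1\}\times S)$; $I(u,v)=(1,s)$ means there is a directed edge from $u$ to $v$ with value $s$. An $S$-path is an $S$-graph whose vertices can be listed as $v_1,\dots,v_n$ so that $I(v_i,v_{i+1})\in\{1\}\times S$ for $1\le i<n$ and all other values of $I$ are $0$; its size is $|G|=n\ge1$. Distinct vertices $u,v$ are joined by an edge if $I(u,v)\ne0$ or $I(v,u)\ne0$; $I(v,v)\ne 0$ is a loop. An $S$-graph is $d$-bounded if every vertex lies on at most $d$ edges, a loop counting as two. Distance is the length of a shortest sequence of consecutive edges, ignoring direction. The $k$-disc of $v$ is the $S$-graph induced by the vertices at distance at most $k$ from $v$, rooted at $v$; isomorphisms of $k$-discs are root-preserving bijections preserving $I$. $\mathcal{L}_S(d,k)$ is the (finite) set of isomorphism types of rooted $d$-bounded $S$-graphs all of whose vertices are at distance at most $k$ from the root, and $L_S(d,k)=|\mathcal{L}_S(d,k)|$. $\mathrm{freq}_k(G)$ is the vector indexed by $\mathcal{L}_S(d,k)$ whose $\Gamma$-entry is the fraction of vertices of $G$ whose $k$-disc is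 isomorphic to $\Gamma$. *)

theory Defs
  imports Complex_Main "HOL-Library.Extended_Nat"
begin

text \<open>
  The value \<open>0\<close> of the function \<open>I\<close> is encoded as \<open>None\<close>, and \<open>(1, s)\<close> as \<open>Some s\<close>.
  Only the values of \<open>val G\<close> on \<open>verts G \<times> verts G\<close> carry meaning; no definition below
  depends on the others.
\<close>

record ('v, 's) sgraph =
  verts :: "'v set"
  val :: "'v \<Rightarrow> 'v \<Rightarrow> 's option"

definition is_sgraph :: "'s set \<Rightarrow> ('v, 's) sgraph \<Rightarrow> bool" where
  "is_sgraph S G \<longleftrightarrow> finite (verts G) \<and>
     (\<forall>u\<in>verts G. \<forall>v\<in>verts G. val G u v \<in> {None} \<union> Some ` S)"

definition is_spath :: "'s set \<Rightarrow> ('v, 's) sgraph \<Rightarrow> bool" where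
  "is_spath S G \<longleftrightarrow> is_sgraph S G \<and>
     (\<exists>vs. vs \<noteq> [] \<and> distinct vs \<and> set vs = verts G \<and>
        (\<forall>i<length vs. \<forall>j<length vs.
           if j = Suc i then val G (vs ! i) (vs ! j) \<in> Some ` S
           else val G (vs ! i) (vs ! j) = None))"

definition sedges :: "('v, 's) sgraph \<Rightarrow> ('v \<times> 'v) set" where
  "sedges G = {(u, v). u \<in> verts G \<and> v \<in> verts G \<and> u \<noteq> v \<and>
                       (val G u v \<noteq> None \<or> val G v u \<noteq> None)}"

text \<open>Two antiparallel directed edges between distinct vertices count as one edge.\<close>

definition sdegree :: "('v, 's) sgraph \<Rightarrow> 'v \<Rightarrow> nat" where
  "sdegree G v = card {u. (v, u) \<in> sedges G} + (if val G v v \<noteq> None then 2 else 0)"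

definition d_bounded :: "nat \<Rightarrow> ('v, 's) sgraph \<Rightarrow> bool" where
  "d_bounded d G \<longleftrightarrow> (\<forall>v\<in>verts G. sdegree G v \<le> d)"

text \<open>The distance is \<open>\<infinity>\<close> between different connected components.\<close>

definition sdist :: "('v, 's) sgraph \<Rightarrow> 'v \<Rightarrow> 'v \<Rightarrow> enat" where
  "sdist G u v = (INF j\<in>{j. (u, v) \<in> sedges G ^^ j}. enat j)"

type_synonym ('v, 's) rooted_sgraph = "('v, 's) sgraph \<times> 'v"

definition disc :: "nat \<Rightarrow> ('v, 's) sgraph \<Rightarrow> 'v \<Rightarrow> ('v, 's) rooted_sgraph" where
  "disc k G v = (\<lparr>verts = {u \<in> verts G. sdist G v u \<le> enat k}, val = val G\<rparr>, v)"

definition rooted_iso :: "('v, 's) rooted_sgraph \<Rightarrow> ('w, 's) rooted_sgraph \<Rightarrow> bool" where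
  "rooted_iso A B \<longleftrightarrow>
     (\<exists>f. bij_betw f (verts (fst A)) (verts (fst B)) \<and> f (snd A) = snd B \<and>
        (\<forall>u\<in>verts (fst A). \<forall>v\<in>verts (fst A). val (fst B) (f u) (f v) = val (fst A) u v))"

text \<open>
  Every finite graph has a copy whose vertices are natural numbers, so isomorphism types are
  taken as isomorphism classes of rooted graphs with vertices in \<open>nat\<close>.
\<close>

definition rooted_sgraphs :: "'s set \<Rightarrow> nat \<Rightarrow> nat \<Rightarrow> (nat, 's) rooted_sgraph set" where
  "rooted_sgraphs S d k =
     {(G, r). is_sgraph S G \<and> d_bounded d G \<and> r \<in> verts G \<and>
              (\<forall>v\<in>verts G. sdist G r v \<le> enat k)}"

definition iso_types :: "'s set \<Rightarrow> nat \<Rightarrow> nat \<Rightarrow> (nat, 's) rooted_sgraph set set" where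
  "iso_types S d k =
     rooted_sgraphs S d k //
       {(A, B) \<in> rooted_sgraphs S d k \<times> rooted_sgraphs S d k. rooted_iso A B}"

definition num_iso_types :: "'s set \<Rightarrow> nat \<Rightarrow> nat \<Rightarrow> nat" where
  "num_iso_types S d k = card (iso_types S d k)"

text \<open>
  A frequency vector is a function on isomorphism types; the parameters \<open>S\<close> and \<open>d\<close> only enter
  through the index set \<open>iso_types S d k\<close> over which the norm is taken.
\<close>

definition freq :: "nat \<Rightarrow> ('v, 's) sgraph \<Rightarrow> (nat, 's) rooted_sgraph set \<Rightarrow> real" where
  "freq k G \<Gamma> =
     real (card {v \<in> verts G. \<exists>H\<in>\<Gamma>. rooted_iso (disc k G v) H}) / real (card (verts G))"

definition l1_norm_on :: "'i set \<Rightarrow> ('i \<Rightarrow> real) \<Rightarrow> real" where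
  "l1_norm_on A x = (\<Sum>i\<in>A. \<bar>x i\<bar>)"


lemma rooted_iso_refl: "rooted_iso A A"
  unfolding rooted_iso_def by (intro exI[of _ id]) auto

lemma rooted_iso_trans:
  assumes "rooted_iso A B" "rooted_iso B C"
  shows "rooted_iso A C"
proof -
  obtain f where f: "bij_betw f (verts (fst A)) (verts (fst B))" "f (snd A) = snd B"
    "\<forall>u\<in>verts (fst A). \<forall>v\<in>verts (fst A). val (fst B) (f u) (f v) = val (fst A) u v"
    using assms(1) unfolding rooted_iso_def by blast
  obtain g where g: "bij_betw g (verts (fst B)) (verts (fst C))" "g (snd B) = snd C"
    "\<forall>u\<in>verts (fst B). \<forall>v\<in>verts (fst B). val (fst C) (g u) (g v) = val (fst B) u v"
    using assms(2) unfolding rooted_iso_def by blast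
  have m: "f u \<in> verts (fst B)" if "u \<in> verts (fst A)" for u
    using f(1) that by (auto simp: bij_betw_def)
  show ?thesis unfolding rooted_iso_def
    using bij_betw_trans[OF f(1) g(1)] f g m by (intro exI[of _ "g \<circ> f"]) auto
qed

lemma rooted_iso_sym:
  assumes "rooted_iso A B" "snd A \<in> verts (fst A)"
  shows "rooted_iso B A"
proof -
  obtain f where f: "bij_betw f (verts (fst A)) (verts (fst B))" "f (snd A) = snd B"
    "\<forall>u\<in>verts (fst A). \<forall>v\<in>verts (fst A). val (fst B) (f u) (f v) = val (fst A) u v"
    using assms(1) unfolding rooted_iso_def by blast
  define g where "g = inv_into (verts (fst A)) f"
  have g: "bij_betw g (verts (fst B)) (verts (fst A))"
    unfolding g_def using f(1) by (rule bij_betw_inv_into)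
  have fg: "f (g w) = w" if "w \<in> verts (fst B)" for w
    unfolding g_def using f(1) that by (rule bij_betw_inv_into_right)
  have r: "g (snd B) = snd A"
    unfolding g_def using bij_betw_inv_into_left[OF f(1) assms(2)] f(2) by simp
  have m: "g w \<in> verts (fst A)" if "w \<in> verts (fst B)" for w
    using g that by (auto simp: bij_betw_def)
  have "val (fst A) (g u) (g v) = val (fst B) u v"
    if "u \<in> verts (fst B)" "v \<in> verts (fst B)" for u v
    using f(3) m[OF that(1)] m[OF that(2)] fg that by metis
  with g r show ?thesis unfolding rooted_iso_def by blast
qed

lemma equiv_rooted_iso:
  "equiv (rooted_sgraphs S d k)
     {(A, B) \<in> rooted_sgraphs S d k \<times> rooted_sgraphs S d k. rooted_iso A B}"
proof (rule equivI)
  show "sym {(A, B) \<in> rooted_sgraphs S d k \<times> rooted_sgraphs S d k. rooted_iso A B}"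
    by (auto simp: sym_def rooted_sgraphs_def intro: rooted_iso_sym)
  show "trans {(A, B) \<in> rooted_sgraphs S d k \<times> rooted_sgraphs S d k. rooted_iso A B}"
    by (rule transI) (auto intro: rooted_iso_trans)
qed (auto simp: refl_on_def intro: rooted_iso_refl)

lemma sdist_le_iff: "sdist G u v \<le> enat k \<longleftrightarrow> (\<exists>j\<le>k. (u, v) \<in> sedges G ^^ j)"
proof
  assume le: "sdist G u v \<le> enat k"
  let ?J = "{j. (u, v) \<in> sedges G ^^ j}"
  have "?J \<noteq> {}"
  proof
    assume e: "?J = {}"
    show False using le unfolding sdist_def e by (simp add: top_enat_def)
  qed
  then have "Inf (enat ` ?J) \<in> enat ` ?J"
    unfolding Inf_enat_def by (auto intro: LeastI)
  then show "\<exists>j\<le>k. (u, v) \<in> sedges G ^^ j"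
    using le unfolding sdist_def by auto
next
  assume "\<exists>j\<le>k. (u, v) \<in> sedges G ^^ j"
  then obtain j where j: "j \<le> k" "(u, v) \<in> sedges G ^^ j" by blast
  have "sdist G u v \<le> enat j"
    unfolding sdist_def by (rule INF_lower) (use j in simp)
  also have "\<dots> \<le> enat k" using j by simp
  finally show "sdist G u v \<le> enat k" .
qed

lemma card_rooted_sgraph_le:
  assumes "(G, r) \<in> rooted_sgraphs S d k"
  shows "card (verts G) \<le> (d + 1) ^ k"
proof -
  have fin: "finite (verts G)" and r: "r \<in> verts G"
    and deg: "\<And>v. v \<in> verts G \<Longrightarrow> sdegree G v \<le> d"
    and near: "\<And>v. v \<in> verts G \<Longrightarrow> \<exists>j\<le>k. (r, v) \<in> sedges G ^^ j"
    using assms by (auto simp: rooted_sgraphs_def is_sgraph_def d_bounded_def sdist_le_iff)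
  define B where "B m = {v \<in> verts G. \<exists>j\<le>m. (r, v) \<in> sedges G ^^ j}" for m
  have finB: "finite (B m)" for m unfolding B_def using fin by simp
  have sub: "B (Suc m) \<subseteq> B m \<union> (\<Union>w\<in>B m. {u. (w, u) \<in> sedges G})" for m
  proof
    fix v assume "v \<in> B (Suc m)"
    then obtain j where v: "v \<in> verts G" and j: "j \<le> Suc m" "(r, v) \<in> sedges G ^^ j"
      unfolding B_def by blast
    show "v \<in> B m \<union> (\<Union>w\<in>B m. {u. (w, u) \<in> sedges G})"
    proof (cases "j \<le> m")
      case True
      then show ?thesis using v j unfolding B_def by blast
    next
      case False
      then have "j = Suc m" using j by simp
      with j obtain w where w: "(r, w) \<in> sedges G ^^ m" "(w, v) \<in> sedges G" by auto
      then have "w \<in> B m" unfolding B_def by (auto simp: sedges_def)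
      then show ?thesis using w by blast
    qed
  qed
  have nb: "card {u. (w, u) \<in> sedges G} \<le> d" if "w \<in> B m" for w m
    using deg[of w] that unfolding B_def sdegree_def by simp
  have finN: "finite {u. (w, u) \<in> sedges G}" for w
    by (rule finite_subset[OF _ fin]) (auto simp: sedges_def)
  have "card (B m) \<le> (d + 1) ^ m" for m
  proof (induction m)
    case 0
    have "B 0 \<subseteq> {r}" by (auto simp: B_def)
    then show ?case using card_mono[of "{r}" "B 0"] by simp
  next
    case (Suc m)
    have "card (B (Suc m)) \<le> card (B m \<union> (\<Union>w\<in>B m. {u. (w, u) \<in> sedges G}))"
      using sub finB finN by (intro card_mono) auto
    also have "\<dots> \<le> card (B m) + card (\<Union>w\<in>B m. {u. (w, u) \<in> sedges G})"
      by (rule card_Un_le)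
    also have "card (\<Union>w\<in>B m. {u. (w, u) \<in> sedges G}) \<le> (\<Sum>w\<in>B m. card {u. (w, u) \<in> sedges G})"
      using finB by (rule card_UN_le)
    also have "\<dots> \<le> card (B m) * d"
      using sum_bounded_above[of "B m" "\<lambda>w. card {u. (w, u) \<in> sedges G}" d] nb by simp
    finally have "card (B (Suc m)) \<le> card (B m) * (d + 1)" by simp
    also have "\<dots> \<le> (d + 1) ^ m * (d + 1)" using Suc by (rule mult_right_mono) simp
    finally show ?case by (simp add: mult.commute)
  qed
  moreover have "verts G = B k" unfolding B_def using near by blast
  ultimately show ?thesis by simp
qed

lemma finite_iso_types:
  fixes S :: "'s set"
  assumes "finite S"
  shows "finite (iso_types S d k)"
proof -
  let ?R = "rooted_sgraphs S d k"
  let ?E = "{(A, B) \<in> ?R \<times> ?R. rooted_iso A B}"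
  define N where "N = (d + 1) ^ k"
  define num where
    "num A = (SOME f. bij_betw f (verts (fst A)) {..<card (verts (fst A))})"
    for A :: "(nat, 's) rooted_sgraph"
  define code where
    "code A = (card (verts (fst A)), num A (snd A),
       {(num A u, num A v, s) | u v s. u \<in> verts (fst A) \<and> v \<in> verts (fst A) \<and> val (fst A) u v = Some s})"
    for A :: "(nat, 's) rooted_sgraph"
  have num: "bij_betw (num A) (verts (fst A)) {..<card (verts (fst A))}" if "A \<in> ?R" for A
  proof -
    have "finite (verts (fst A))" using that by (auto simp: rooted_sgraphs_def is_sgraph_def)
    from ex_bij_betw_finite_nat[OF this] show ?thesis
      unfolding num_def atLeast0LessThan by (rule someI_ex)
  qed
  have iso: "rooted_iso A B" if A: "A \<in> ?R" and B: "B \<in> ?R" and eq: "code A = code B" for A B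
  proof -
    let ?V = "verts (fst A)" and ?W = "verts (fst B)"
    have c: "card ?V = card ?W" and rt: "num A (snd A) = num B (snd B)"
      and es: "{(num A u, num A v, s) | u v s. u \<in> ?V \<and> v \<in> ?V \<and> val (fst A) u v = Some s}
             = {(num B u, num B v, s) | u v s. u \<in> ?W \<and> v \<in> ?W \<and> val (fst B) u v = Some s}"
      using eq by (auto simp: code_def)
    have rB: "snd B \<in> ?W" using B by (auto simp: rooted_sgraphs_def)
    define g where "g = inv_into ?W (num B)"
    have g: "bij_betw g {..<card ?V} ?W"
      unfolding g_def c using num[OF B] by (rule bij_betw_inv_into)
    have ng: "num B (g i) = i" if "i < card ?V" for i
      unfolding g_def using bij_betw_inv_into_right[OF num[OF B]] that c by simp
    have injA: "inj_on (num A) ?V" and injB: "inj_on (num B) ?W"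
      using num[OF A] num[OF B] by (auto simp: bij_betw_def)
    have bij: "bij_betw (g \<circ> num A) ?V ?W"
      using num[OF A] g by (rule bij_betw_trans)
    have mem: "g (num A u) \<in> ?W" and nn: "num B (g (num A u)) = num A u" if "u \<in> ?V" for u
      using bij ng num[OF A] that by (auto simp: bij_betw_def)
    have root: "g (num A (snd A)) = snd B"
      unfolding g_def rt using bij_betw_inv_into_left[OF num[OF B] rB] .
    have "val (fst B) (g (num A u)) (g (num A v)) = val (fst A) u v"
      if uv: "u \<in> ?V" "v \<in> ?V" for u v
    proof -
      have "val (fst A) u v = Some s \<longleftrightarrow> val (fst B) (g (num A u)) (g (num A v)) = Some s" for s
      proof -
        have "val (fst A) u v = Some s \<longleftrightarrow> (num A u, num A v, s) \<in>
           {(num A u, num A v, s) | u v s. u \<in> ?V \<and> v \<in> ?V \<and> val (fst A) u v = Some s}"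
          using uv injA by (auto dest: inj_onD)
        also have "\<dots> \<longleftrightarrow> (num B (g (num A u)), num B (g (num A v)), s) \<in>
           {(num B u, num B v, s) | u v s. u \<in> ?W \<and> v \<in> ?W \<and> val (fst B) u v = Some s}"
          unfolding es nn[OF uv(1)] nn[OF uv(2)] ..
        also have "\<dots> \<longleftrightarrow> val (fst B) (g (num A u)) (g (num A v)) = Some s"
          using mem[OF uv(1)] mem[OF uv(2)] injB by (auto dest: inj_onD)
        finally show ?thesis .
      qed
      then show ?thesis by (metis option.exhaust)
    qed
    with bij root show ?thesis unfolding rooted_iso_def by (intro exI[of _ "g \<circ> num A"]) auto
  qed
  have "code ` ?R \<subseteq> {..N} \<times> {..<N} \<times> Pow ({..<N} \<times> {..<N} \<times> S)"
  proof
    fix x assume "x \<in> code ` ?R"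
    then obtain A where A: "A \<in> ?R" and x: "x = code A" by blast
    have le: "card (verts (fst A)) \<le> N"
      using card_rooted_sgraph_le[of "fst A" "snd A" S d k] A by (simp add: N_def)
    have lt: "num A u < N" if "u \<in> verts (fst A)" for u
      using bij_betw_apply[OF num[OF A] that] le by simp
    have s: "s \<in> S"
      if "u \<in> verts (fst A)" "v \<in> verts (fst A)" "val (fst A) u v = Some s" for u v s
    proof -
      have "val (fst A) u v \<in> {None} \<union> Some ` S"
        using A that(1,2) unfolding rooted_sgraphs_def is_sgraph_def by fastforce
      then show ?thesis using that(3) by auto
    qed
    have "snd A \<in> verts (fst A)" using A by (auto simp: rooted_sgraphs_def)
    with le lt s show "x \<in> {..N} \<times> {..<N} \<times> Pow ({..<N} \<times> {..<N} \<times> S)"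
      unfolding x code_def by auto
  qed
  then have fc: "finite (code ` ?R)"
    by (rule finite_subset) (use assms in simp)
  have "iso_types S d k \<subseteq> (\<lambda>c. ?E `` {SOME A. A \<in> ?R \<and> code A = c}) ` (code ` ?R)"
  proof
    fix \<Gamma> assume "\<Gamma> \<in> iso_types S d k"
    then obtain A where A: "A \<in> ?R" and \<Gamma>: "\<Gamma> = ?E `` {A}"
      unfolding iso_types_def by (auto elim: quotientE)
    let ?B = "SOME B. B \<in> ?R \<and> code B = code A"
    have B: "?B \<in> ?R \<and> code ?B = code A"
      by (rule someI[of _ A]) (use A in simp)
    then have "(A, ?B) \<in> ?E" using A iso[of A ?B] by auto
    then have "\<Gamma> = ?E `` {?B}" unfolding \<Gamma> by (rule equiv_class_eq[OF equiv_rooted_iso])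
    then show "\<Gamma> \<in> (\<lambda>c. ?E `` {SOME A. A \<in> ?R \<and> code A = c}) ` (code ` ?R)"
      using A by blast
  qed
  then show ?thesis using fc finite_surj by blast
qed

end

theory Submission
  imports Defs "HOL-Analysis.Convex"
begin

text \<open>
  An \<open>S\<close>-path is a word \<open>w\<close> over \<open>S\<close>, and the \<open>k\<close>-disc of a vertex is described by the
  window of \<open>w\<close> around its position, i.e. the (at most) \<open>k\<close> letters before and after it.
  Different windows give non-isomorphic discs (\<open>rooted_path_iso_imp_eq\<close>), so the number \<open>N\<close>
  of windows is at most \<open>L\<^sub>S(d,k)\<close>, and it suffices to approximate the window frequencies of \<open>w\<close>
  by those of a short word.

  Now regard windows as states and read \<open>w\<close> as a walk through its consecutive windows. Any walk
  along compatible windows with the same first and last state is again the window sequence of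
  a word (\<open>windows_of_walk\<close>), and truncated windows are states like all others. So
  the question becomes one about walks in an arbitrary finite directed graph with \<open>N\<close> states:
  to find a short walk with the same endpoints and almost the same visit frequencies
  (\<open>short_walk_with_close_frequencies\<close>).

  For this, cut simple cycles out of the walk until a skeleton of length at most
  \<open>N + N\<^sup>2\<close> is left which still visits every state (\<open>walk_skeleton_decomposition\<close>). The
  frequencies of a long walk are essentially the average of those of its cycles. A greedy choice
  of \<open>T\<close> cycles, each keeping the accumulated error at a non-positive inner product with the next
  contribution (\<open>balanced_selection\<close>), has total error of order \<open>sqrt T\<close> rather than \<open>T\<close>.
  Every cycle can be inserted into the skeleton, which visits all states, without disturbing
  the rest (\<open>walk_insert_cycles\<close>). Taking \<open>T\<close> of order \<open>N ^ 3 / \<epsilon>\<^sup>2\<close> gives a walk of length at most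
  \<open>19 * N ^ 4 / \<epsilon>\<^sup>2\<close>, which is well below the asserted bound.
\<close>

section \<open>Short walks with prescribed visit frequencies\<close>

definition simple_cycle :: "('x \<Rightarrow> 'x \<Rightarrow> bool) \<Rightarrow> 'x list \<Rightarrow> bool" where
  "simple_cycle R c \<longleftrightarrow> c \<noteq> [] \<and> distinct c \<and> successively R (c @ [hd c])"

text \<open>Cutting simple cycles out of a walk must stop before a state is lost, since the cycles can
  only be put back at states that the remaining walk still visits. The recursion runs from the
  end of the walk and keeps the remainder in the form \<open>p @ q\<close>: the suffix \<open>q\<close> guards
  every state seen so far, so that vertices of the distinct prefix \<open>p\<close> may be removed freely.
  A new state turns \<open>s # p\<close> into guarded material; this happens at most \<open>card X\<close> times and
  costs at most \<open>card X\<close> vertices each time. A state already in \<open>p\<close> closes a simple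
  cycle, which is cut out.\<close>

lemma walk_skeleton_decomposition:
  assumes "ts \<noteq> []" and "finite X"
  shows "successively R ts \<Longrightarrow> set ts \<subseteq> X \<Longrightarrow>
    \<exists>p q cs. distinct p \<and> set p \<subseteq> set q \<and> set q = set ts \<and> q \<noteq> [] \<and>
      successively R (p @ q) \<and> hd (p @ q) = hd ts \<and> last q = last ts \<and>
      length q \<le> card X * card (set q) \<and>
      (\<forall>c\<in>set cs. simple_cycle R c \<and> set c \<subseteq> set ts) \<and>
      (\<forall>x. count_list ts x = count_list (p @ q) x + (\<Sum>c\<leftarrow>cs. count_list c x))"
  using assms(1)
proof (induction ts rule: list_nonempty_induct)
  case (single s)
  then have "1 \<le> card X" using \<open>finite X\<close> by (auto simp: Suc_le_eq card_gt_0_iff)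
  then show ?case by (intro exI[of _ "[]"] exI[of _ "[s]"]) auto
next
  case (cons s ts)
  then have "successively R ts" "set ts \<subseteq> X" and s: "R s (hd ts)" "s \<in> X"
    by (auto simp: successively_Cons)
  then obtain p q cs where pq: "distinct p" "set p \<subseteq> set q" "set q = set ts" "q \<noteq> []"
      "successively R (p @ q)" "hd (p @ q) = hd ts" "last q = last ts"
      "length q \<le> card X * card (set q)"
    and cs: "\<And>c. c \<in> set cs \<Longrightarrow> simple_cycle R c \<and> set c \<subseteq> set ts"
    and cnt: "\<And>x. count_list ts x = count_list (p @ q) x + (\<Sum>c\<leftarrow>cs. count_list c x)"
    using cons.IH by blast
  have walk: "successively R (s # p @ q)" using pq s by (simp add: successively_Cons)
  consider "s \<notin> set q" | "s \<in> set q" "s \<notin> set p" | "s \<in> set p" by blast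
  then show ?case
  proof cases
    case 1
    have "length (s # p) \<le> card X"
      using 1 pq s \<open>set ts \<subseteq> X\<close> \<open>finite X\<close>
      by (subst distinct_card[symmetric]) (auto intro!: card_mono)
    then have "length (s # p @ q) \<le> card X * card (set (s # p @ q))"
      using pq 1 by (auto simp: insert_absorb Un_absorb1)
    then show ?thesis using 1 pq walk cs cnt cons.hyps
      by (intro exI[of _ "[]"] exI[of _ "s # p @ q"] exI[of _ cs]) auto
  next
    case 2
    then show ?thesis using pq walk cs cnt cons.hyps
      by (intro exI[of _ "s # p"] exI[of _ q] exI[of _ cs]) auto
  next
    case 3
    then obtain p1 p2 where p: "p = p1 @ s # p2" by (meson split_list)
    have "simple_cycle R (s # p1)"
      using pq(1) walk unfolding p simple_cycle_def
      by (auto simp: successively_append_iff successively_Cons hd_append split: if_splits)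
    moreover have "successively R (s # p2 @ q)"
      using pq(5) unfolding p by (auto simp: successively_append_iff)
    ultimately show ?thesis using pq cs cnt cons.hyps unfolding p
      by (intro exI[of _ "s # p2"] exI[of _ q] exI[of _ "(s # p1) # cs"]) auto
  qed
qed

lemma walk_insert_cycles:
  assumes "ts \<noteq> []" and "successively R ts"
    and "\<forall>c\<in>set ds. simple_cycle R c \<and> set c \<subseteq> set ts"
  shows "\<exists>us. us \<noteq> [] \<and> successively R us \<and> set us = set ts \<and> hd us = hd ts \<and> last us = last ts \<and>
           (\<forall>x. count_list us x = count_list ts x + (\<Sum>c\<leftarrow>ds. count_list c x))"
  using assms(3)
proof (induction ds)
  case Nil
  then show ?case using assms by auto
next
  case (Cons c ds)
  then obtain us where us: "us \<noteq> []" "successively R us" "set us = set ts" "hd us = hd ts"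
      "last us = last ts" "\<And>x. count_list us x = count_list ts x + (\<Sum>c\<leftarrow>ds. count_list c x)"
    by auto
  have c: "c \<noteq> []" "successively R (c @ [hd c])" "set c \<subseteq> set us"
    using Cons.prems us unfolding simple_cycle_def by auto
  then have "hd c \<in> set us" by (meson hd_in_set subsetD)
  then obtain x y where xy: "us = x @ hd c # y" by (meson split_list)
  have "successively R (x @ c @ hd c # y)"
    using us(2) c(1,2) unfolding xy by (auto simp: successively_append_iff)
  moreover have "hd (x @ c @ hd c # y) = hd ts" using us(4) c(1) unfolding xy
    by (auto simp: hd_append)
  moreover have "last (x @ c @ hd c # y) = last ts" using us(5) unfolding xy by auto
  moreover have "set (x @ c @ hd c # y) = set ts" using us(3) c(3) unfolding xy by auto
  moreover have "count_list (x @ c @ hd c # y) z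
      = count_list ts z + (\<Sum>c\<leftarrow>c # ds. count_list c z)" for z
    using us(6)[of z] unfolding xy by auto
  ultimately show ?case by (intro exI[of _ "x @ c @ hd c # y"]) auto
qed

lemma sum_list_sum_swap:
  fixes f :: "'c \<Rightarrow> 'x \<Rightarrow> 'a::comm_monoid_add"
  shows "(\<Sum>c\<leftarrow>cs. \<Sum>x\<in>X. f c x) = (\<Sum>x\<in>X. \<Sum>c\<leftarrow>cs. f c x)"
  by (induction cs) (simp_all add: sum.distrib)

text \<open>Greedy form of the averaging argument of Maurey. The inner products of the current partial sum
  with the vectors of the family add up to \<open>0\<close>, so one of these vectors makes an inner
  product at most \<open>0\<close> with it; adding that vector increases the squared Euclidean norm by at
  most \<open>B\<close>.\<close>

lemma balanced_selection:
  fixes v :: "'c \<Rightarrow> 'x \<Rightarrow> real"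
  assumes "cs \<noteq> []" and zero: "\<And>x. x \<in> X \<Longrightarrow> (\<Sum>c\<leftarrow>cs. v c x) = 0"
    and B: "\<And>c. c \<in> set cs \<Longrightarrow> (\<Sum>x\<in>X. (v c x)\<^sup>2) \<le> B"
  shows "\<exists>ds. length ds = n \<and> set ds \<subseteq> set cs \<and> (\<Sum>x\<in>X. (\<Sum>c\<leftarrow>ds. v c x)\<^sup>2) \<le> real n * B"
proof (induction n)
  case 0
  then show ?case by simp
next
  case (Suc n)
  then obtain ds where ds: "length ds = n" "set ds \<subseteq> set cs"
    "(\<Sum>x\<in>X. (\<Sum>c\<leftarrow>ds. v c x)\<^sup>2) \<le> real n * B" by blast
  define V where "V x = (\<Sum>c\<leftarrow>ds. v c x)" for x
  have "(\<Sum>c\<leftarrow>cs. \<Sum>x\<in>X. V x * v c x) = (\<Sum>x\<in>X. V x * (\<Sum>c\<leftarrow>cs. v c x))"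
    by (simp add: sum_list_sum_swap sum_list_const_mult)
  also have "\<dots> = 0" by (simp add: zero)
  finally have total: "(\<Sum>c\<leftarrow>cs. \<Sum>x\<in>X. V x * v c x) = 0" .
  have "\<exists>c\<in>set cs. (\<Sum>x\<in>X. V x * v c x) \<le> 0"
  proof (rule ccontr)
    assume "\<not> ?thesis"
    then have "(\<Sum>c\<leftarrow>cs. 0) < (\<Sum>c\<leftarrow>cs. \<Sum>x\<in>X. V x * v c x)"
      using \<open>cs \<noteq> []\<close> by (intro sum_list_strict_mono) auto
    then show False using total by simp
  qed
  then obtain c where c: "c \<in> set cs" "(\<Sum>x\<in>X. V x * v c x) \<le> 0" by blast
  have "(\<Sum>x\<in>X. (v c x + V x)\<^sup>2)
      = (\<Sum>x\<in>X. (v c x)\<^sup>2) + (\<Sum>x\<in>X. (V x)\<^sup>2) + 2 * (\<Sum>x\<in>X. V x * v c x)"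
    by (simp add: power2_sum sum.distrib sum_distrib_left algebra_simps)
  also have "\<dots> \<le> B + real n * B + 0"
    using B[OF c(1)] ds(3) c(2) unfolding V_def by (intro add_mono) auto
  finally have "(\<Sum>x\<in>X. (\<Sum>c\<leftarrow>c # ds. v c x)\<^sup>2) \<le> real (Suc n) * B"
    by (simp add: V_def algebra_simps)
  then show ?case using ds c by (intro exI[of _ "c # ds"]) auto
qed

lemma sum_count_list_concat:
  assumes "finite X" and "\<forall>c\<in>set cs. set c \<subseteq> X"
  shows "(\<Sum>x\<in>X. \<Sum>c\<leftarrow>cs. count_list c x) = (\<Sum>c\<leftarrow>cs. length c)"
proof -
  have "(\<Sum>x\<in>X. \<Sum>c\<leftarrow>cs. count_list c x) = (\<Sum>c\<leftarrow>cs. \<Sum>x\<in>X. count_list c x)"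
    by (simp add: sum_list_sum_swap)
  also have "\<dots> = (\<Sum>c\<leftarrow>cs. length c)"
    using assms by (intro arg_cong[where f = sum_list] map_cong sum_count_set) auto
  finally show ?thesis .
qed

text \<open>The vectors to which the balancing is applied: the visit counts of a simple cycle, minus those
  expected for its length under the distribution \<open>p\<close>. Subtracting a multiple of \<open>p\<close>
  that depends on the length avoids any comparison between cycles of different lengths.\<close>

lemma sum_squares_cycle_deviation_le:
  fixes p :: "'x \<Rightarrow> real"
  assumes "finite X" and "distinct c" and "set c \<subseteq> X"
    and p: "\<And>x. x \<in> X \<Longrightarrow> 0 \<le> p x" "(\<Sum>x\<in>X. p x) = 1"
  shows "(\<Sum>x\<in>X. (real (count_list c x) - real (length c) * p x)\<^sup>2) \<le> 2 * (real (card X))\<^sup>2"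
proof -
  let ?l = "real (length c)" and ?N = "real (card X)"
  have le: "length c \<le> card X"
    using assms by (subst distinct_card[symmetric]) (auto intro: card_mono)
  have p1: "p x \<le> 1" if "x \<in> X" for x
    using member_le_sum[OF that, of p] p \<open>finite X\<close> by auto
  have bit: "count_list c x \<le> 1" for x
    using \<open>distinct c\<close> by (induction c) auto
  have "(real (count_list c x) - ?l * p x)\<^sup>2 \<le> real (count_list c x) + ?l\<^sup>2 * p x" if "x \<in> X" for x
  proof -
    let ?u = "real (count_list c x)"
    have "(?u - ?l * p x)\<^sup>2 \<le> ?u\<^sup>2 + (?l * p x)\<^sup>2"
      using p(1)[OF that] by (simp add: power2_diff)
    also have "\<dots> \<le> ?u + ?l\<^sup>2 * p x"
    proof (rule add_mono)
      show "?u\<^sup>2 \<le> ?u" using bit[of x] by (auto simp: power2_eq_square intro: mult_left_le)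
      show "(?l * p x)\<^sup>2 \<le> ?l\<^sup>2 * p x"
        unfolding power_mult_distrib using p(1)[OF that] p1[OF that]
        by (intro mult_left_mono) (auto simp: power2_eq_square intro: mult_left_le)
    qed
    finally show ?thesis .
  qed
  then have "(\<Sum>x\<in>X. (real (count_list c x) - ?l * p x)\<^sup>2)
      \<le> (\<Sum>x\<in>X. real (count_list c x) + ?l\<^sup>2 * p x)" by (rule sum_mono)
  also have "\<dots> = ?l + ?l\<^sup>2"
    using sum_count_set[OF \<open>set c \<subseteq> X\<close> \<open>finite X\<close>] p(2)
    by (simp add: sum.distrib flip: sum_distrib_left of_nat_sum)
  also have "\<dots> \<le> ?N\<^sup>2 + ?N\<^sup>2"
  proof (rule add_mono)
    show "?l\<^sup>2 \<le> ?N\<^sup>2" using le by (intro power_mono) auto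
    have "length c \<le> (length c)\<^sup>2" by (cases c) (simp_all add: power2_eq_square)
    then have "?l \<le> ?l\<^sup>2" by (metis of_nat_le_iff of_nat_power)
    with \<open>?l\<^sup>2 \<le> ?N\<^sup>2\<close> show "?l \<le> ?N\<^sup>2" by linarith
  qed
  finally show ?thesis by simp
qed

text \<open>Let \<open>N = card X\<close>. The walk is its skeleton, of length at most \<open>2 * N\<^sup>2\<close>, plus
  simple cycles. If the cycles have total length at least \<open>T\<close>, they are replaced by \<open>T\<close>
  of them, chosen by \<open>balanced_selection\<close>. Both walks then have frequencies close to
  the overall cycle frequencies \<open>f\<close>: the skeleton perturbs each by \<open>O(N\<^sup>2 / T)\<close>, and by
  Cauchy-Schwarz the selection contributes at most
  \<open>sqrt (N * (T * 2 * N\<^sup>2)) / T = O(sqrt (N ^ 3 / T))\<close>. Hence \<open>T\<close> of order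
  \<open>N ^ 3 / e\<^sup>2\<close> suffices, and each selected cycle has length at most \<open>N\<close>. If the
  cycles are shorter than \<open>T\<close> in total, the walk itself is short enough.\<close>

lemma short_walk_with_close_frequencies:
  fixes e :: real and X :: "'x set"
  assumes "finite X" and "ts \<noteq> []" and "set ts \<subseteq> X" and "successively R ts"
    and e: "0 < e" "e \<le> 1"
  shows "\<exists>us. us \<noteq> [] \<and> set us = set ts \<and> successively R us \<and> hd us = hd ts \<and> last us = last ts \<and>
    real (length us) \<le> 19 * real (card X) ^ 4 / e\<^sup>2 \<and>
    (\<Sum>x\<in>X. \<bar>count_list ts x / length ts - count_list us x / length us\<bar>) \<le> e"
proof -
  define N where "N = real (card X)"
  \<comment> \<open>The skeleton enters both frequency vectors and costs at most \<open>8 * N\<^sup>2 / T\<close>, the selection at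
    most \<open>sqrt (2 * N ^ 3 / T)\<close>; the constant 16 makes each of them at most \<open>e / 2\<close>.\<close>
  define T where "T = nat \<lceil>16 * N ^ 3 / e\<^sup>2\<rceil>"
  have "card X > 0" using assms by (auto simp: card_gt_0_iff)
  then have N: "N \<ge> 1" by (simp add: N_def)
  have e2: "0 < e\<^sup>2" "e\<^sup>2 \<le> 1" using e by (auto simp: power_le_one)
  have "16 * 1 / 1 \<le> 16 * N ^ 3 / e\<^sup>2"
    using N e2 by (intro frac_le mult_left_mono) (auto simp: one_le_power)
  then have T: "16 * N ^ 3 / e\<^sup>2 \<le> real T" "real T \<le> 16 * N ^ 3 / e\<^sup>2 + 1" "T > 0"
    unfolding T_def by linarith+
  obtain p q cs where pq: "distinct p" "set p \<subseteq> set q" "set q = set ts" "q \<noteq> []"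
      "successively R (p @ q)" "hd (p @ q) = hd ts" "last q = last ts"
      "length q \<le> card X * card (set q)"
    and cs: "\<And>c. c \<in> set cs \<Longrightarrow> simple_cycle R c \<and> set c \<subseteq> set ts"
    and cnt: "\<And>x. count_list ts x = count_list (p @ q) x + (\<Sum>c\<leftarrow>cs. count_list c x)"
    using walk_skeleton_decomposition[OF assms(2,1,4,3)] by blast
  define sk where "sk = p @ q"
  define K where "K = (\<Sum>c\<leftarrow>cs. length c)"
  have subX: "set c \<subseteq> X" if "c \<in> set cs" for c using cs[OF that] assms(3) by blast
  have sk: "sk \<noteq> []" "set sk = set ts" "successively R sk" "hd sk = hd ts" "last sk = last ts"
    using pq unfolding sk_def by auto
  have len_sk: "real (length sk) \<le> 2 * N\<^sup>2"
  proof -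
    have "length p \<le> card X"
      using pq(1,2,3) assms(1,3) by (subst distinct_card[symmetric]) (auto intro!: card_mono)
    moreover have "card (set q) \<le> card X" using pq(3) assms(1,3) by (auto intro: card_mono)
    ultimately have "length sk \<le> card X + card X * card X"
      using le_trans[OF pq(8) mult_le_mono2] unfolding sk_def by (simp add: add_mono)
    also have "\<dots> \<le> 2 * (card X)\<^sup>2" using \<open>card X > 0\<close> by (simp add: power2_eq_square)
    finally have "real (length sk) \<le> real (2 * (card X)\<^sup>2)" by (rule of_nat_mono)
    then show ?thesis by (simp add: N_def)
  qed
  have sum_cs: "(\<Sum>x\<in>X. \<Sum>c\<leftarrow>cs. count_list c x) = K"
    unfolding K_def using sum_count_list_concat[OF assms(1)] subX by blast
  have sum_sk: "(\<Sum>x\<in>X. count_list sk x) = length sk"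
    using sk assms(1,3) by (intro sum_count_set) auto
  have len_ts: "length ts = length sk + K"
    using sum_count_set[OF assms(3,1)] sum_cs sum_sk by (simp add: cnt sk_def sum.distrib)
  have len_bound: "2 * N\<^sup>2 + N * T \<le> 19 * N ^ 4 / e\<^sup>2"
  proof -
    have p4: "N ^ 2 \<le> N ^ 4" "N \<le> N ^ 4" using N power_increasing[of _ 4 N] self_le_power[of N 4] by auto
    have "N ^ 4 \<le> N ^ 4 / e\<^sup>2" using e2 N by (simp add: field_simps mult_left_le)
    moreover have "N * T \<le> N * (16 * N ^ 3 / e\<^sup>2 + 1)" using T N by (intro mult_left_mono) auto
    then have "N * T \<le> 16 * (N ^ 4 / e\<^sup>2) + N" by (simp add: algebra_simps power_numeral_reduce)
    ultimately show ?thesis using p4 by linarith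
  qed
  show ?thesis
  proof (cases "K < T")
    case True
    have "real T \<le> N * T" using N by (simp add: mult_le_cancel_right1)
    moreover have "real (length ts) \<le> 2 * N\<^sup>2 + real T" using len_ts len_sk True by simp
    ultimately have "real (length ts) \<le> 19 * N ^ 4 / e\<^sup>2" using len_bound by linarith
    then show ?thesis using assms unfolding N_def by (intro exI[of _ ts]) auto
  next
    case False
    then have K: "T \<le> K" "K > 0" using T by auto
    then have "cs \<noteq> []" unfolding K_def by auto
    define f where "f x = real (\<Sum>c\<leftarrow>cs. count_list c x) / real K" for x
    have f0: "0 \<le> f x" for x unfolding f_def by simp
    have f1: "(\<Sum>x\<in>X. f x) = 1"
      unfolding f_def sum_divide_distrib[symmetric] of_nat_sum[symmetric] sum_cs using K by simp
    define v where "v c x = real (count_list c x) - real (length c) * f x" for c x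
    have v_sum: "(\<Sum>c\<leftarrow>ds. v c x) = real (\<Sum>c\<leftarrow>ds. count_list c x) - real (\<Sum>c\<leftarrow>ds. length c) * f x"
      for ds x by (induction ds) (auto simp: v_def algebra_simps)
    have zero: "(\<Sum>c\<leftarrow>cs. v c x) = 0" for x
      unfolding v_sum using K by (simp add: f_def flip: K_def)
    have v_bound: "(\<Sum>x\<in>X. (v c x)\<^sup>2) \<le> 2 * N\<^sup>2" if "c \<in> set cs" for c
      unfolding v_def N_def using assms(1) cs[OF that] subX[OF that] f0 f1
      by (intro sum_squares_cycle_deviation_le) (auto simp: simple_cycle_def)
    obtain ds where ds: "length ds = T" "set ds \<subseteq> set cs"
      "(\<Sum>x\<in>X. (\<Sum>c\<leftarrow>ds. v c x)\<^sup>2) \<le> real T * (2 * N\<^sup>2)"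
      using balanced_selection[OF \<open>cs \<noteq> []\<close> zero v_bound] by blast
    define M where "M = (\<Sum>c\<leftarrow>ds. length c)"
    define z where "z x = (\<Sum>c\<leftarrow>ds. v c x)" for x
    have cyc_len: "1 \<le> length c" "length c \<le> card X" if "c \<in> set ds" for c
    proof -
      have c: "c \<noteq> []" "distinct c" "set c \<subseteq> X"
        using that ds cs subX unfolding simple_cycle_def by blast+
      then show "1 \<le> length c" by (simp add: Suc_le_eq)
      show "length c \<le> card X"
        using c assms(1) by (subst distinct_card[symmetric]) (auto intro: card_mono)
    qed
    have "(\<Sum>c\<leftarrow>ds. 1) \<le> M" unfolding M_def by (intro sum_list_mono) (use cyc_len in auto)
    then have M: "T \<le> M" by (simp add: ds(1) sum_list_triv)
    have "M \<le> (\<Sum>c\<leftarrow>ds. card X)" unfolding M_def by (intro sum_list_mono) (use cyc_len in auto)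
    then have "M \<le> T * card X" by (simp add: ds(1) sum_list_triv)
    then have "real M \<le> real (T * card X)" by (rule of_nat_mono)
    then have M': "real M \<le> N * T" by (simp add: N_def mult.commute)
    obtain us where us: "us \<noteq> []" "successively R us" "set us = set sk" "hd us = hd sk"
      "last us = last sk" "\<And>x. count_list us x = count_list sk x + (\<Sum>c\<leftarrow>ds. count_list c x)"
      using walk_insert_cycles[of sk R ds] sk cs ds(2) by blast
    have sum_ds: "(\<Sum>x\<in>X. \<Sum>c\<leftarrow>ds. count_list c x) = M"
      unfolding M_def using sum_count_list_concat[OF assms(1)] subX ds(2) by blast
    have len_us: "length us = length sk + M"
      using sum_count_set[of us X] sum_ds sum_sk us(3,6) sk(2) assms(1,3)
      by (simp add: sum.distrib)
    \<comment> \<open>\<open>r\<close> is the deviation of the skeleton and \<open>z\<close> that of the selected cycles, both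
      measured against \<open>f\<close>: the counts are \<open>length ts * f + r\<close> in the old walk and
      \<open>length us * f + (r + z)\<close> in the new one.\<close>
    define r where "r x = real (count_list sk x) - real (length sk) * f x" for x
    have r: "(\<Sum>x\<in>X. \<bar>r x\<bar>) \<le> 4 * N\<^sup>2"
    proof -
      have "(\<Sum>x\<in>X. \<bar>r x\<bar>) \<le> (\<Sum>x\<in>X. real (count_list sk x) + real (length sk) * f x)"
      proof (rule sum_mono)
        fix x
        have "0 \<le> real (length sk) * f x" using f0 by simp
        then show "\<bar>r x\<bar> \<le> real (count_list sk x) + real (length sk) * f x"
          unfolding r_def by linarith
      qed
      also have "\<dots> = 2 * real (length sk)"
        using sum_sk f1 by (simp add: sum.distrib flip: sum_distrib_left of_nat_sum)
      finally show ?thesis using len_sk by simp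
    qed
    have z: "(\<Sum>x\<in>X. \<bar>z x\<bar>) \<le> e / 2 * T"
    proof (rule power2_le_imp_le)
      have "(\<Sum>x\<in>X. \<bar>z x\<bar>)\<^sup>2 \<le> (\<Sum>x\<in>X. (z x)\<^sup>2) * N"
        using sum_squared_le_sum_of_squares[of "\<lambda>x. \<bar>z x\<bar>" X] by (simp add: N_def)
      also have "\<dots> \<le> real T * (2 * N\<^sup>2) * N"
        using ds(3) N unfolding z_def by (intro mult_right_mono) auto
      also have "\<dots> = T * (2 * N ^ 3)" by (simp add: power2_eq_square power3_eq_cube)
      also have "\<dots> \<le> T * ((e / 2)\<^sup>2 * T)"
      proof (rule mult_left_mono)
        have "16 * N ^ 3 \<le> e\<^sup>2 * T" using T(1) e2 by (simp add: field_simps)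
        moreover have "0 \<le> N ^ 3" using N by simp
        ultimately have "2 * N ^ 3 \<le> e\<^sup>2 * T / 4" by linarith
        then show "2 * N ^ 3 \<le> (e / 2)\<^sup>2 * T" by (simp add: power_divide)
      qed simp
      also have "\<dots> = (e / 2 * T)\<^sup>2" by (simp add: power2_eq_square)
      finally show "(\<Sum>x\<in>X. \<bar>z x\<bar>)\<^sup>2 \<le> (e / 2 * T)\<^sup>2" .
    qed (use e in simp)
    have point: "\<bar>count_list ts x / length ts - count_list us x / length us\<bar> \<le> (2 * \<bar>r x\<bar> + \<bar>z x\<bar>) / T"
      for x
    proof -
      let ?a = "real (length ts)" and ?b = "real (length us)"
      have pos: "0 < real T" "real T \<le> ?a" "real T \<le> ?b" using T M K len_ts len_us by auto
      then have nz: "ts \<noteq> []" "us \<noteq> []" by auto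
      have "real (count_list ts x) = ?a * f x + r x"
      proof -
        have "real (\<Sum>c\<leftarrow>cs. count_list c x) = K * f x" using K by (simp add: f_def)
        then show ?thesis unfolding cnt len_ts r_def by (simp add: sk_def algebra_simps)
      qed
      then have 1: "count_list ts x / ?a = f x + r x / ?a" using nz by (simp add: add_divide_distrib)
      have "real (count_list us x) = ?b * f x + (r x + z x)"
        unfolding us(6) len_us r_def z_def v_sum M_def by (simp add: algebra_simps)
      then have 2: "count_list us x / ?b = f x + (r x + z x) / ?b" using nz by (simp add: add_divide_distrib)
      have "\<bar>r x / ?a\<bar> \<le> \<bar>r x\<bar> / T" "\<bar>(r x + z x) / ?b\<bar> \<le> (\<bar>r x\<bar> + \<bar>z x\<bar>) / T"
        unfolding abs_divide using pos by (auto intro!: frac_le)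
      moreover have "(2 * \<bar>r x\<bar> + \<bar>z x\<bar>) / T = \<bar>r x\<bar> / T + (\<bar>r x\<bar> + \<bar>z x\<bar>) / T"
        by (simp add: add_divide_distrib)
      ultimately show ?thesis unfolding 1 2 by linarith
    qed
    have "(\<Sum>x\<in>X. \<bar>count_list ts x / length ts - count_list us x / length us\<bar>)
        \<le> (\<Sum>x\<in>X. (2 * \<bar>r x\<bar> + \<bar>z x\<bar>) / T)" by (rule sum_mono) (rule point)
    also have "\<dots> = (2 * (\<Sum>x\<in>X. \<bar>r x\<bar>) + (\<Sum>x\<in>X. \<bar>z x\<bar>)) / T"
      by (simp add: sum_divide_distrib[symmetric] sum.distrib sum_distrib_left)
    also have "\<dots> \<le> e"
    proof -
      have "e\<^sup>2 \<le> e" using e by (simp add: power2_eq_square mult_left_le)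
      then have "16 * N ^ 3 \<le> e * T"
        using T(1) e2 mult_right_mono[of "e\<^sup>2" e "real T"] by (simp add: field_simps)
      moreover have "N\<^sup>2 \<le> N ^ 3" using N by (intro power_increasing) auto
      ultimately have "2 * (\<Sum>x\<in>X. \<bar>r x\<bar>) + (\<Sum>x\<in>X. \<bar>z x\<bar>) \<le> e * T" using r z by simp
      then show ?thesis using T(3) by (simp add: field_simps)
    qed
    finally have "(\<Sum>x\<in>X. \<bar>count_list ts x / length ts - count_list us x / length us\<bar>) \<le> e" .
    moreover have "real (length us) \<le> 19 * N ^ 4 / e\<^sup>2"
      using len_us len_sk M' len_bound by simp
    ultimately show ?thesis using us sk unfolding N_def by (intro exI[of _ us]) auto
  qed
qed

section \<open>Discs in paths and windows of words\<close>

text \<open>The list \<open>vs\<close> enumerates the vertices of a path in order and \<open>w\<close> lists the values of its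
  consecutive edges. Everything about an \<open>S\<close>-path up to isomorphism is in the word \<open>w\<close>.\<close>

definition spells :: "('v, 's) sgraph \<Rightarrow> 'v list \<Rightarrow> 's list \<Rightarrow> bool" where
  "spells G vs w \<longleftrightarrow> distinct vs \<and> set vs = verts G \<and> length vs = Suc (length w) \<and>
     (\<forall>i<length vs. \<forall>j<length vs.
        val G (vs ! i) (vs ! j) = (if j = Suc i then Some (w ! i) else None))"

lemma is_spath_iff_spells: "is_spath S G \<longleftrightarrow> (\<exists>vs w. set w \<subseteq> S \<and> spells G vs w)"
proof
  assume "is_spath S G"
  then obtain vs where vs: "vs \<noteq> []" "distinct vs" "set vs = verts G"
    and v: "\<forall>i<length vs. \<forall>j<length vs.
           if j = Suc i then val G (vs ! i) (vs ! j) \<in> Some ` S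
           else val G (vs ! i) (vs ! j) = None"
    unfolding is_spath_def by blast
  define w where "w = map (\<lambda>i. the (val G (vs ! i) (vs ! Suc i))) [0..<length vs - 1]"
  have len: "length vs = Suc (length w)" using vs by (simp add: w_def)
  have lab: "val G (vs ! i) (vs ! Suc i) = Some (w ! i) \<and> w ! i \<in> S" if "i < length w" for i
  proof -
    have "val G (vs ! i) (vs ! Suc i) \<in> Some ` S" using v that len by auto
    then show ?thesis using that by (auto simp: w_def)
  qed
  have "set w \<subseteq> S" using lab by (auto simp: in_set_conv_nth)
  moreover have "spells G vs w" unfolding spells_def using vs len v lab by auto
  ultimately show "\<exists>vs w. set w \<subseteq> S \<and> spells G vs w" by blast
next
  assume "\<exists>vs w. set w \<subseteq> S \<and> spells G vs w"
  then obtain vs w where w: "set w \<subseteq> S" and sp: "spells G vs w" by blast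
  have "w ! i \<in> S" if "i < length w" for i using w that nth_mem by blast
  then have lab: "if j = Suc i then val G (vs ! i) (vs ! j) \<in> Some ` S
      else val G (vs ! i) (vs ! j) = None" if "i < length vs" "j < length vs" for i j
    using sp that unfolding spells_def by auto
  have "is_sgraph S G"
    unfolding is_sgraph_def
  proof (intro conjI ballI)
    show "finite (verts G)" using sp unfolding spells_def by (metis List.finite_set)
    fix u v assume "u \<in> verts G" "v \<in> verts G"
    then obtain i j where "i < length vs" "u = vs ! i" "j < length vs" "v = vs ! j"
      using sp unfolding spells_def by (metis in_set_conv_nth)
    then show "val G u v \<in> {None} \<union> Some ` S" using lab[of i j] by (auto split: if_splits)
  qed
  moreover have "vs \<noteq> []" using sp unfolding spells_def by auto
  ultimately show "is_spath S G"
    unfolding is_spath_def using lab sp unfolding spells_def by blast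
qed

lemma spells_sedges_iff:
  assumes "spells G vs w" and "i < length vs" and "j < length vs"
  shows "(vs ! i, vs ! j) \<in> sedges G \<longleftrightarrow> j = Suc i \<or> i = Suc j"
  using assms nth_eq_iff_index_eq[of vs i j] nth_mem[of i vs] nth_mem[of j vs]
  unfolding spells_def sedges_def by auto

lemma spells_sdist_le_iff:
  assumes sp: "spells G vs w" and "i < length vs" and "j < length vs"
  shows "sdist G (vs ! i) (vs ! j) \<le> enat k \<longleftrightarrow> i \<le> j + k \<and> j \<le> i + k"
proof
  have far: "\<exists>l<length vs. y = vs ! l \<and> i \<le> l + m \<and> l \<le> i + m"
    if "(vs ! i, y) \<in> sedges G ^^ m" for y m
    using that
  proof (induction m arbitrary: y)
    case 0
    then show ?case using assms by auto
  next
    case (Suc m)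
    then obtain l where l: "l < length vs" "(vs ! l, y) \<in> sedges G" "i \<le> l + m" "l \<le> i + m"
      by auto
    then have "y \<in> set vs" using sp by (auto simp: sedges_def spells_def)
    then obtain l' where l': "l' < length vs" "y = vs ! l'" by (auto simp: in_set_conv_nth)
    then have "l' = Suc l \<or> l = Suc l'" using l spells_sedges_iff[OF sp] by blast
    then show ?case using l l' by (intro exI[of _ l']) auto
  qed
  assume "sdist G (vs ! i) (vs ! j) \<le> enat k"
  then obtain m where m: "m \<le> k" "(vs ! i, vs ! j) \<in> sedges G ^^ m" by (auto simp: sdist_le_iff)
  obtain l where l: "l < length vs" "vs ! j = vs ! l" "i \<le> l + m" "l \<le> i + m"
    using far[OF m(2)] by blast
  have "j = l" using l sp assms(3) by (auto simp: spells_def nth_eq_iff_index_eq)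
  then show "i \<le> j + k \<and> j \<le> i + k" using l m by auto
next
  have near: "(vs ! i, vs ! (i + m)) \<in> sedges G ^^ m \<and> (vs ! (i + m), vs ! i) \<in> sedges G ^^ m"
    if "i + m < length vs" for i m
    using that
  proof (induction m)
    case (Suc m)
    have "(vs ! (i + m), vs ! (i + Suc m)) \<in> sedges G" "(vs ! (i + Suc m), vs ! (i + m)) \<in> sedges G"
      using Suc.prems spells_sedges_iff[OF sp] by auto
    then show ?case using Suc by (metis Suc_lessD add_Suc_right relpow_Suc_I relpow_Suc_I2)
  qed simp
  assume "i \<le> j + k \<and> j \<le> i + k"
  then show "sdist G (vs ! i) (vs ! j) \<le> enat k"
    unfolding sdist_le_iff using near[of i "j - i"] near[of j "i - j"] assms
    by (cases "i \<le> j") (auto intro: exI[of _ "j - i"] exI[of _ "i - j"])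
qed

definition path_graph :: "'s list \<Rightarrow> (nat, 's) sgraph" where
  "path_graph w = \<lparr>verts = {..length w},
     val = \<lambda>i j. if j = Suc i \<and> i < length w then Some (w ! i) else None\<rparr>"

lemma spells_path_graph: "spells (path_graph w) [0..<Suc (length w)] w"
  unfolding spells_def path_graph_def by (auto simp del: upt_Suc)

text \<open>The word seen from position \<open>i\<close>: up to \<open>k\<close> letters before it and up to \<open>k\<close> after it.
  Near the ends of \<open>w\<close> (where \<open>i - k\<close> is truncated to \<open>0\<close>, or \<open>drop i w\<close> is short) a part
  has fewer than \<open>k\<close> letters, as the disc there is cut off.\<close>

definition window :: "nat \<Rightarrow> 's list \<Rightarrow> nat \<Rightarrow> 's list \<times> 's list" where
  "window k w i = (drop (i - k) (take i w), take k (drop i w))"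

definition rooted_path :: "'s list \<times> 's list \<Rightarrow> (nat, 's) rooted_sgraph" where
  "rooted_path \<tau> = (path_graph (fst \<tau> @ snd \<tau>), length (fst \<tau>))"

lemma disc_iso_rooted_path:
  assumes sp: "spells G vs w" and i: "i < length vs"
  shows "rooted_iso (disc k G (vs ! i)) (rooted_path (window k w i))"
\<comment> \<open>From the window to the disc the isomorphism is an explicit shift, by the position
  \<open>i - k\<close> at which the window begins.\<close>
proof (rule rooted_iso_sym)
  let ?o = "i - k"
  obtain a b where ab: "window k w i = (a, b)" by fastforce
  define m where "m = length (a @ b)"
  have len: "length vs = Suc (length w)" using sp by (simp add: spells_def)
  have a: "a = drop ?o (take i w)" and b: "b = take k (drop i w)"
    using ab by (auto simp: window_def)
  have la: "length a = i - ?o" and lb: "length b = min k (length w - i)"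
    using i len by (auto simp: a b)
  have nth: "(a @ b) ! j = w ! (j + ?o)" if "j < m" for j
    using that i len la unfolding m_def by (auto simp: a b nth_append add.commute)
  have m: "m + ?o = min (i + k) (length w)" using la lb i len by (auto simp: m_def)
  let ?g = "\<lambda>j. vs ! (j + ?o)"
  have dv: "verts (fst (disc k G (vs ! i))) = {vs ! j | j. j \<le> length w \<and> i \<le> j + k \<and> j \<le> i + k}"
  proof -
    have "verts G = {vs ! j | j. j \<le> length w}"
      using sp set_conv_nth[of vs] len by (auto simp: spells_def less_Suc_eq_le)
    then show ?thesis
      using spells_sdist_le_iff[OF sp i] len by (auto simp: disc_def)
  qed
  show "rooted_iso (rooted_path (window k w i)) (disc k G (vs ! i))"
    unfolding rooted_iso_def
  proof (intro exI[of _ ?g] conjI ballI)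
    have inj: "inj_on ?g {..m}"
      using sp len m by (auto simp: inj_on_def spells_def nth_eq_iff_index_eq)
    have "?g ` {..m} = verts (fst (disc k G (vs ! i)))"
    proof
      show "?g ` {..m} \<subseteq> verts (fst (disc k G (vs ! i)))" unfolding dv using m by auto
      show "verts (fst (disc k G (vs ! i))) \<subseteq> ?g ` {..m}"
      proof
        fix v assume "v \<in> verts (fst (disc k G (vs ! i)))"
        then obtain j where "v = vs ! j" "j \<le> length w" "i \<le> j + k" "j \<le> i + k"
          unfolding dv by blast
        then show "v \<in> ?g ` {..m}" using m by (intro image_eqI[of _ _ "j - ?o"]) auto
      qed
    qed
    then show "bij_betw ?g (verts (fst (rooted_path (window k w i)))) (verts (fst (disc k G (vs ! i))))"
      using inj by (simp add: bij_betw_def rooted_path_def path_graph_def ab m_def)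
    show "?g (snd (rooted_path (window k w i))) = snd (disc k G (vs ! i))"
      by (simp add: rooted_path_def ab disc_def la)
    fix u v assume "u \<in> verts (fst (rooted_path (window k w i)))"
      "v \<in> verts (fst (rooted_path (window k w i)))"
    then have uv: "u \<le> m" "v \<le> m" by (auto simp: rooted_path_def path_graph_def ab m_def)
    then have "u + ?o < length vs" "v + ?o < length vs" using m len by auto
    then have "val G (?g u) (?g v) = (if v = Suc u then Some (w ! (u + ?o)) else None)"
      using sp unfolding spells_def by auto
    then show "val (fst (disc k G (vs ! i))) (?g u) (?g v)
        = val (fst (rooted_path (window k w i))) u v"
      using uv nth[of u] by (auto simp: disc_def rooted_path_def path_graph_def ab m_def)
  qed
  show "snd (rooted_path (window k w i)) \<in> verts (fst (rooted_path (window k w i)))"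
    by (simp add: rooted_path_def path_graph_def)
qed

text \<open>An isomorphism preserves the direction of edges, so it maps \<open>Suc u\<close> to \<open>Suc (f u)\<close> and is
  a shift; being a bijection between initial segments, it is the identity. Hence discs in
  paths and windows carry the same information.\<close>

lemma rooted_path_iso_imp_eq:
  assumes "rooted_iso (rooted_path \<sigma>) (rooted_path \<tau>)"
  shows "\<sigma> = \<tau>"
proof -
  define x y where "x = fst \<sigma> @ snd \<sigma>" and "y = fst \<tau> @ snd \<tau>"
  obtain f where bij: "bij_betw f {..length x} {..length y}"
    and root: "f (length (fst \<sigma>)) = length (fst \<tau>)"
    and val: "\<And>u v. u \<le> length x \<Longrightarrow> v \<le> length x \<Longrightarrow>
      (if f v = Suc (f u) \<and> f u < length y then Some (y ! f u) else None)
        = (if v = Suc u \<and> u < length x then Some (x ! u) else None)"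
    using assms unfolding rooted_iso_def rooted_path_def path_graph_def x_def y_def
    by (auto simp del: length_append)
  have step: "f (Suc u) = Suc (f u) \<and> y ! f u = x ! u" if "u < length x" for u
    using val[of u "Suc u"] that by (auto split: if_splits)
  have shift: "f u = u + f 0" if "u \<le> length x" for u
    using that by (induction u) (auto simp: step)
  have len: "length x = length y" using bij_betw_same_card[OF bij] by simp
  have "f (length x) \<le> length y" using bij by (auto simp: bij_betw_def)
  then have "f 0 = 0" using shift[of "length x"] len by simp
  then have id: "f u = u" if "u \<le> length x" for u using shift[OF that] by simp
  have "x = y" using step id len by (intro nth_equalityI) auto
  moreover have "length (fst \<sigma>) = length (fst \<tau>)" using root id[of "length (fst \<sigma>)"] by (simp add: x_def)
  ultimately show ?thesis unfolding x_def y_def by (auto simp: prod_eq_iff)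
qed

definition windows_over :: "'s set \<Rightarrow> nat \<Rightarrow> ('s list \<times> 's list) set" where
  "windows_over S k = {a. set a \<subseteq> S \<and> length a \<le> k} \<times> {b. set b \<subseteq> S \<and> length b \<le> k}"

lemma finite_windows_over: "finite S \<Longrightarrow> finite (windows_over S k)"
  unfolding windows_over_def by (simp add: finite_lists_length_le)

lemma rooted_path_in_rooted_sgraphs:
  assumes "\<tau> \<in> windows_over S k" and "d \<ge> 2"
  shows "rooted_path \<tau> \<in> rooted_sgraphs S d k"
proof -
  obtain a b where \<tau>: "\<tau> = (a, b)" by fastforce
  then have ab: "set a \<subseteq> S" "set b \<subseteq> S" "length a \<le> k" "length b \<le> k"
    using assms by (auto simp: windows_over_def)
  let ?G = "path_graph (a @ b)" and ?vs = "[0..<Suc (length (a @ b))]"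
  have sp: "spells ?G ?vs (a @ b)" by (rule spells_path_graph)
  have V: "verts ?G = {..length (a @ b)}" by (simp add: path_graph_def)
  have "is_sgraph S ?G"
    using is_spath_iff_spells[of S ?G] sp ab unfolding is_spath_def by auto
  moreover have "sdegree ?G u \<le> d" for u
  proof -
    have "{v. (u, v) \<in> sedges ?G} \<subseteq> {u - 1, Suc u}"
      by (auto simp: sedges_def path_graph_def split: if_splits)
    then have "card {v. (u, v) \<in> sedges ?G} \<le> card {u - 1, Suc u}" by (intro card_mono) auto
    also have "\<dots> \<le> 2" by (simp add: card_insert_if)
    finally show ?thesis using assms(2) by (simp add: sdegree_def path_graph_def)
  qed
  moreover have "sdist ?G (length a) v \<le> enat k" if "v \<in> verts ?G" for v
  proof -
    have "sdist ?G (?vs ! length a) (?vs ! v) \<le> enat k"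
      using that ab V by (subst spells_sdist_le_iff[OF sp]) auto
    then show ?thesis using that V by (simp del: upt_Suc)
  qed
  ultimately show ?thesis
    using V by (simp add: rooted_sgraphs_def rooted_path_def \<tau> d_bounded_def)
qed

text \<open>This is how the number of states of the window walk is controlled by the number of
  isomorphism types, without counting either of them.\<close>

lemma card_windows_over_le:
  assumes "finite S" and "d \<ge> 2"
  shows "card (windows_over S k) \<le> num_iso_types S d k"
  unfolding num_iso_types_def
proof (rule card_inj_on_le)
  let ?R = "rooted_sgraphs S d k"
  let ?E = "{(A, B) \<in> ?R \<times> ?R. rooted_iso A B}"
  show "inj_on (\<lambda>\<tau>. ?E `` {rooted_path \<tau>}) (windows_over S k)"
  proof (rule inj_onI)
    fix \<sigma> \<tau> assume st: "\<sigma> \<in> windows_over S k" "\<tau> \<in> windows_over S k"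
      and eq: "?E `` {rooted_path \<sigma>} = ?E `` {rooted_path \<tau>}"
    have "(rooted_path \<sigma>, rooted_path \<tau>) \<in> ?E"
      using eq_equiv_class[OF eq equiv_rooted_iso] rooted_path_in_rooted_sgraphs st assms(2) by blast
    then show "\<sigma> = \<tau>" using rooted_path_iso_imp_eq by blast
  qed
  show "(\<lambda>\<tau>. ?E `` {rooted_path \<tau>}) ` windows_over S k \<subseteq> iso_types S d k"
    unfolding iso_types_def
    by (intro image_subsetI quotientI rooted_path_in_rooted_sgraphs assms(2))
  show "finite (iso_types S d k)" using assms(1) by (rule finite_iso_types)
qed

definition windows :: "nat \<Rightarrow> 's list \<Rightarrow> ('s list \<times> 's list) list" where
  "windows k w = map (window k w) [0..<Suc (length w)]"

lemma set_windows_subset: "set w \<subseteq> S \<Longrightarrow> set (windows k w) \<subseteq> windows_over S k"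
  by (auto simp: windows_def windows_over_def window_def simp del: upt_Suc
           dest!: in_set_dropD in_set_takeD)

lemma set_subset_if_windows:
  assumes "k \<ge> 1" and "set (windows k w) \<subseteq> windows_over S k"
  shows "set w \<subseteq> S"
proof
  fix s assume "s \<in> set w"
  then obtain i where i: "i < length w" "s = w ! i" by (auto simp: in_set_conv_nth)
  then have "s \<in> set (snd (window k w i))"
    using \<open>k \<ge> 1\<close> by (cases k) (auto simp: window_def Cons_nth_drop_Suc[symmetric])
  moreover have "window k w i \<in> windows_over S k"
    using i assms(2) by (auto simp: windows_def simp del: upt_Suc)
  ultimately show "s \<in> S" by (auto simp: windows_over_def)
qed

definition windows_of_type :: "(nat, 's) rooted_sgraph set \<Rightarrow> ('s list \<times> 's list) set" where
  "windows_of_type \<Gamma> = {\<tau>. \<exists>H\<in>\<Gamma>. rooted_iso (rooted_path \<tau>) H}"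

text \<open>The isomorphism type of a disc is determined by its window, so the frequency of a type is a
  sum of window frequencies.\<close>

lemma freq_spells:
  fixes G :: "('v, 's) sgraph"
  assumes sp: "spells G vs w" and "set w \<subseteq> S" and "finite S"
  shows "freq k G \<Gamma> = (\<Sum>\<tau>\<in>windows_over S k \<inter> windows_of_type \<Gamma>.
           count_list (windows k w) \<tau> / length (windows k w))"
proof -
  let ?W = "windows k w" and ?C = "windows_of_type \<Gamma>"
  have len: "length ?W = length vs" using sp by (simp add: windows_def spells_def)
  have iso: "(\<exists>H\<in>\<Gamma>. rooted_iso (disc k G (vs ! i)) H) \<longleftrightarrow> ?W ! i \<in> ?C" if i: "i < length vs" for i
  proof -
    have eq: "?W ! i = window k w i" using i len by (simp add: windows_def del: upt_Suc)
    have 1: "rooted_iso (disc k G (vs ! i)) (rooted_path (?W ! i))"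
      unfolding eq by (rule disc_iso_rooted_path[OF sp i])
    have "vs ! i \<in> verts (fst (disc k G (vs ! i)))"
      using spells_sdist_le_iff[OF sp i i, of k] sp i by (auto simp: disc_def spells_def)
    then have 2: "rooted_iso (rooted_path (?W ! i)) (disc k G (vs ! i))"
      using rooted_iso_sym[OF 1] by (simp add: disc_def)
    have "rooted_iso (disc k G (vs ! i)) H \<longleftrightarrow> rooted_iso (rooted_path (?W ! i)) H"
      for H :: "(nat, 's) rooted_sgraph"
      by (rule iffI[OF rooted_iso_trans[OF 2] rooted_iso_trans[OF 1]])
    then show ?thesis unfolding windows_of_type_def by simp
  qed
  have "{v \<in> verts G. \<exists>H\<in>\<Gamma>. rooted_iso (disc k G v) H} = (!) vs ` {i. i < length vs \<and> ?W ! i \<in> ?C}"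
  proof -
    have "verts G = (!) vs ` {..<length vs}"
      using sp nth_image[of "length vs" vs] by (simp add: spells_def atLeast0LessThan)
    then show ?thesis using iso by (auto simp: Compr_image_eq intro!: arg_cong[where f = "(`) ((!) vs)"])
  qed
  moreover have "inj_on ((!) vs) {i. i < length vs \<and> ?W ! i \<in> ?C}"
    using sp by (auto simp: inj_on_def spells_def nth_eq_iff_index_eq)
  ultimately have "card {v \<in> verts G. \<exists>H\<in>\<Gamma>. rooted_iso (disc k G v) H}
      = length (filter (\<lambda>\<tau>. \<tau> \<in> ?C) ?W)"
    by (simp add: card_image length_filter_conv_card len)
  also have "\<dots> = (\<Sum>\<tau>\<in>windows_over S k \<inter> ?C. count_list (filter (\<lambda>\<tau>. \<tau> \<in> ?C) ?W) \<tau>)"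
    using set_windows_subset[OF assms(2), of k] finite_windows_over[OF assms(3), of k]
    by (intro sum_count_set[symmetric]) auto
  also have "\<dots> = (\<Sum>\<tau>\<in>windows_over S k \<inter> ?C. count_list ?W \<tau>)"
    by (intro sum.cong) (auto simp: count_list_eq_length_filter intro!: arg_cong[where f = length] filter_cong)
  finally have "card {v \<in> verts G. \<exists>H\<in>\<Gamma>. rooted_iso (disc k G v) H}
      = (\<Sum>\<tau>\<in>windows_over S k \<inter> ?C. count_list ?W \<tau>)" .
  moreover have "card (verts G) = length ?W"
    using sp len by (metis distinct_card spells_def)
  ultimately show ?thesis unfolding freq_def by (simp add: sum_divide_distrib)
qed

lemma windows_of_type_disjoint:
  assumes "\<Gamma> \<in> iso_types S d k" and "\<Delta> \<in> iso_types S d k" and "\<Gamma> \<noteq> \<Delta>"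
  shows "windows_of_type \<Gamma> \<inter> windows_of_type \<Delta> = {}"
proof (rule ccontr)
  let ?R = "rooted_sgraphs S d k"
  let ?E = "{(A, B) \<in> ?R \<times> ?R. rooted_iso A B}"
  assume "\<not> ?thesis"
  then obtain \<tau> A B where AB: "A \<in> \<Gamma>" "B \<in> \<Delta>"
    and iso: "rooted_iso (rooted_path \<tau>) A" "rooted_iso (rooted_path \<tau>) B"
    unfolding windows_of_type_def by blast
  have "snd (rooted_path \<tau>) \<in> verts (fst (rooted_path \<tau>))"
    by (simp add: rooted_path_def path_graph_def)
  then have "rooted_iso A B" using rooted_iso_sym[OF iso(1)] rooted_iso_trans iso(2) by blast
  moreover have "A \<in> ?R" "B \<in> ?R"
    using AB assms(1,2) in_quotient_imp_subset[OF equiv_rooted_iso] unfolding iso_types_def by blast+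
  ultimately have "(A, B) \<in> ?E" by simp
  then have "\<Gamma> = \<Delta>"
    by (rule quotient_eqI[OF equiv_rooted_iso assms(1,2)[unfolded iso_types_def] AB])
  then show False using assms(3) by simp
qed

text \<open>Passing from windows to isomorphism types only merges entries, which cannot increase the
  norm of a difference.\<close>

lemma l1_freq_diff_le:
  assumes "spells G vs w" "spells H us x" "set w \<subseteq> S" "set x \<subseteq> S" "finite S"
  shows "l1_norm_on (iso_types S d k) (\<lambda>\<Gamma>. freq k G \<Gamma> - freq k H \<Gamma>)
    \<le> (\<Sum>\<tau>\<in>windows_over S k. \<bar>count_list (windows k w) \<tau> / length (windows k w)
                               - count_list (windows k x) \<tau> / length (windows k x)\<bar>)"
    (is "_ \<le> (\<Sum>\<tau>\<in>?X. \<bar>?D \<tau>\<bar>)")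
proof -
  have finX: "finite ?X" using assms(5) by (rule finite_windows_over)
  have "l1_norm_on (iso_types S d k) (\<lambda>\<Gamma>. freq k G \<Gamma> - freq k H \<Gamma>)
      = (\<Sum>\<Gamma>\<in>iso_types S d k. \<bar>\<Sum>\<tau>\<in>?X \<inter> windows_of_type \<Gamma>. ?D \<tau>\<bar>)"
    unfolding l1_norm_on_def using assms by (simp add: freq_spells sum_subtractf)
  also have "\<dots> \<le> (\<Sum>\<Gamma>\<in>iso_types S d k. \<Sum>\<tau>\<in>?X \<inter> windows_of_type \<Gamma>. \<bar>?D \<tau>\<bar>)"
    by (intro sum_mono sum_abs)
  also have "\<dots> = (\<Sum>\<tau>\<in>(\<Union>\<Gamma>\<in>iso_types S d k. ?X \<inter> windows_of_type \<Gamma>). \<bar>?D \<tau>\<bar>)"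
    using finX finite_iso_types[OF assms(5)] windows_of_type_disjoint
    by (intro sum.UNION_disjoint[symmetric]) blast+
  also have "\<dots> \<le> (\<Sum>\<tau>\<in>?X. \<bar>?D \<tau>\<bar>)" using finX by (intro sum_mono2) auto
  finally show ?thesis .
qed

section \<open>Words as walks on windows\<close>

text \<open>Compatibility of the windows at two consecutive positions: reading a letter \<open>s\<close> removes it
  from the front of the forward part and appends it to the backward part, of which the last
  \<open>k\<close> letters are kept.\<close>

definition window_step :: "nat \<Rightarrow> 's list \<times> 's list \<Rightarrow> 's list \<times> 's list \<Rightarrow> bool" where
  "window_step k \<sigma> \<tau> \<longleftrightarrow> (\<exists>s. snd \<sigma> = take k (s # snd \<tau>) \<and>
     fst \<tau> = drop (Suc (length (fst \<sigma>)) - k) (fst \<sigma> @ [s]))"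

lemma window_Suc_fst:
  assumes "i < length w"
  shows "fst (window k w (Suc i))
    = drop (Suc (length (fst (window k w i))) - k) (fst (window k w i) @ [w ! i])"
proof -
  have "fst (window k w i) @ [w ! i] = drop (i - k) (take (Suc i) w)"
    using assms by (simp add: window_def take_Suc_conv_app_nth)
  moreover have "length (fst (window k w i)) = i - (i - k)"
    using assms by (simp add: window_def)
  moreover have "Suc (i - (i - k)) - k + (i - k) = Suc i - k" by simp
  ultimately show ?thesis by (simp add: window_def)
qed

lemma window_Suc_snd:
  assumes "i < length w"
  shows "snd (window k w i) = take k (w ! i # snd (window k w (Suc i)))"
  using assms by (cases k) (simp_all add: window_def Cons_nth_drop_Suc[symmetric] min_def)

lemma windows_walk: "successively (window_step k) (windows k w)"
  unfolding successively_conv_nth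
proof (intro allI impI)
  fix i assume "Suc i < length (windows k w)"
  then have "i < length w" "windows k w ! i = window k w i" "windows k w ! Suc i = window k w (Suc i)"
    by (auto simp: windows_def simp del: upt_Suc)
  then show "window_step k (windows k w ! i) (windows k w ! Suc i)"
    unfolding window_step_def using window_Suc_fst[of i w k] window_Suc_snd[of i w k] by metis
qed

text \<open>Walks along compatible windows are exactly the window sequences of words, provided that they
  start with nothing behind and end with nothing ahead. The word is read off from the first
  forward letters, for which \<open>k \<ge> 1\<close> is needed. Backward parts agree by induction from the
  start of the word, forward parts by induction from its end.\<close>

lemma windows_of_walk:
  assumes "k \<ge> 1" and "ts \<noteq> []" and walk: "successively (window_step k) ts"
    and first: "fst (hd ts) = []" and last: "snd (last ts) = []"
  shows "windows k (map (hd \<circ> snd) (butlast ts)) = ts"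
proof -
  define w where "w = map (hd \<circ> snd) (butlast ts)"
  have len: "length ts = Suc (length w)" using \<open>ts \<noteq> []\<close> by (simp add: w_def)
  have letter: "snd (ts ! i) = take k (w ! i # snd (ts ! Suc i))"
      "fst (ts ! Suc i) = drop (Suc (length (fst (ts ! i))) - k) (fst (ts ! i) @ [w ! i])"
    if i: "i < length w" for i
  proof -
    have "window_step k (ts ! i) (ts ! Suc i)"
      using successively_nth[OF walk] i len by simp
    then obtain s where s: "snd (ts ! i) = take k (s # snd (ts ! Suc i))"
      "fst (ts ! Suc i) = drop (Suc (length (fst (ts ! i))) - k) (fst (ts ! i) @ [s])"
      unfolding window_step_def by blast
    have "w ! i = hd (snd (ts ! i))" using i by (simp add: w_def nth_butlast)
    then have "w ! i = s" using s(1) \<open>k \<ge> 1\<close> by (cases k) auto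
    then show "snd (ts ! i) = take k (w ! i # snd (ts ! Suc i))"
      "fst (ts ! Suc i) = drop (Suc (length (fst (ts ! i))) - k) (fst (ts ! i) @ [w ! i])"
      using s by auto
  qed
  have fst: "fst (ts ! i) = fst (window k w i)" if "i \<le> length w" for i
    using that
  proof (induction i)
    case 0
    then show ?case using first \<open>ts \<noteq> []\<close> by (simp add: window_def hd_conv_nth)
  next
    case (Suc i)
    then show ?case using letter(2)[of i] window_Suc_fst[of i w k] by simp
  qed
  have snd: "snd (ts ! i) = snd (window k w i)" if "i \<le> length w" for i
    using that
  proof (induction i rule: inc_induct)
    case base
    then show ?case using last \<open>ts \<noteq> []\<close> len by (simp add: window_def last_conv_nth)
  next
    case (step i)
    then show ?case using letter(1)[of i] window_Suc_snd[of i w k] by simp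
  qed
  have "windows k w = ts"
    using len fst snd
    by (intro nth_equalityI) (auto simp: windows_def prod_eq_iff simp del: upt_Suc)
  then show ?thesis by (simp add: w_def)
qed

section \<open>Short paths with prescribed disc frequencies\<close>

theorem theorem13p2:
  fixes S :: "'s set" and d k :: nat and \<epsilon> :: real and P :: "('v, 's) sgraph"
  assumes "finite S" and "S \<noteq> {}"
    and "d \<ge> 2" and "k \<ge> 1"
    and "0 < \<epsilon>" and "\<epsilon> < 1"
    and "is_spath S P"
  shows "\<exists>Q :: (nat, 's) sgraph. is_spath S Q \<and>
           l1_norm_on (iso_types S d k) (\<lambda>\<Gamma>. freq k P \<Gamma> - freq k Q \<Gamma>) \<le> \<epsilon> \<and>
           real (card (verts Q)) \<le>
             24960 * real d ^ (3 * k) * real (card S) ^ 2 * real (num_iso_types S d k) ^ 6 / \<epsilon> ^ 2"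
proof -
  let ?X = "windows_over S k"
  define N L where "N = real (card ?X)" and "L = real (num_iso_types S d k)"
  have finX: "finite ?X" using assms(1) by (rule finite_windows_over)
  obtain vs w where w: "set w \<subseteq> S" and P: "spells P vs w"
    using assms(7) unfolding is_spath_iff_spells by blast
  have "windows k w \<noteq> []" by (simp add: windows_def)
  then obtain us where us: "us \<noteq> []" "set us = set (windows k w)" "successively (window_step k) us"
      "hd us = hd (windows k w)" "last us = last (windows k w)"
      "real (length us) \<le> 19 * N ^ 4 / \<epsilon>\<^sup>2"
    and close: "(\<Sum>\<tau>\<in>?X. \<bar>count_list (windows k w) \<tau> / length (windows k w)
                  - count_list us \<tau> / length us\<bar>) \<le> \<epsilon>"
    using short_walk_with_close_frequencies[OF finX _ set_windows_subset[OF w] windows_walk, of \<epsilon>]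
      assms(5,6) unfolding N_def by auto
  define x where "x = map (hd \<circ> snd) (butlast us)"
  have "fst (hd us) = []" "snd (last us) = []"
    unfolding us(4,5) by (simp_all add: windows_def window_def hd_map last_map del: upt_Suc)
  then have win: "windows k x = us"
    unfolding x_def using windows_of_walk assms(4) us(1,3) by blast
  have x: "set x \<subseteq> S"
    using set_subset_if_windows[OF assms(4)] win us(2) set_windows_subset[OF w] by metis
  have Q: "spells (path_graph x) [0..<Suc (length x)] x" by (rule spells_path_graph)
  have "1 \<le> L" "N \<le> L"
  proof -
    have "windows k w ! 0 \<in> ?X"
      using set_windows_subset[OF w] \<open>windows k w \<noteq> []\<close> by (meson length_greater_0_conv nth_mem subsetD)
    then have "1 \<le> card ?X" using finX by (auto simp: Suc_le_eq card_gt_0_iff)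
    then show "N \<le> L" "1 \<le> L"
      using card_windows_over_le[OF assms(1,3), of k] by (auto simp: N_def L_def)
  qed
  have "real (card (verts (path_graph x))) = real (length us)"
    by (simp add: path_graph_def windows_def flip: win)
  also have "\<dots> \<le> 24960 * real d ^ (3 * k) * real (card S) ^ 2 * L ^ 6 / \<epsilon>\<^sup>2"
  proof -
    have "1 \<le> real (card S)" using assms(1,2) by (simp add: Suc_le_eq card_gt_0_iff)
    then have "1 * 1 \<le> real d ^ (3 * k) * real (card S) ^ 2"
      using assms(3) by (intro mult_mono one_le_power) auto
    moreover have "N ^ 4 \<le> L ^ 6"
      using power_mono[OF \<open>N \<le> L\<close>, of 4] power_increasing[OF _ \<open>1 \<le> L\<close>, of 4 6]
      by (simp add: N_def)
    ultimately have "1 * N ^ 4 \<le> (real d ^ (3 * k) * real (card S) ^ 2) * L ^ 6"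
      by (intro mult_mono) (auto simp: N_def)
    then have "19 * N ^ 4 \<le> 24960 * ((real d ^ (3 * k) * real (card S) ^ 2) * L ^ 6)"
    proof -
      have "0 \<le> N ^ 4" by (simp add: N_def)
      with \<open>1 * N ^ 4 \<le> _\<close> show ?thesis by linarith
    qed
    then have "19 * N ^ 4 / \<epsilon>\<^sup>2 \<le> 24960 * ((real d ^ (3 * k) * real (card S) ^ 2) * L ^ 6) / \<epsilon>\<^sup>2"
      by (rule divide_right_mono) simp
    with us(6) show ?thesis by (simp only: mult.assoc)
  qed
  finally have "real (card (verts (path_graph x)))
      \<le> 24960 * real d ^ (3 * k) * real (card S) ^ 2 * L ^ 6 / \<epsilon>\<^sup>2" .
  moreover have "is_spath S (path_graph x)" unfolding is_spath_iff_spells using Q x by blast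
  moreover have "l1_norm_on (iso_types S d k) (\<lambda>\<Gamma>. freq k P \<Gamma> - freq k (path_graph x) \<Gamma>) \<le> \<epsilon>"
    by (rule order_trans[OF l1_freq_diff_le[OF P Q w x assms(1)]]) (unfold win, rule close)
  ultimately show ?thesis unfolding L_def by blast
qed

end
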